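(* Let $(\mathbb{R}^{3},g_{Sol})$ denote Sol space, where the metric with respect to the standard coordinates $(x,y,z)$ in $\mathbb{R}^{3}$ is $g_{Sol}=e^{2z}{\rm d}x^{2}+e^{-2z}{\rm d}y^{2}+{\rm d}z^{2}$. Let $A_1,A_2,A_3$ be real $m\times m$ matrices. Then the quadratic map $\varphi:\mathbb{R}^{m}\to(\mathbb{R}^{3},g_{Sol})$, $\varphi(X)=(X^{t}A_{1}X,X^{t}A_{2}X,X^{t}A_{3}X)$ (with the standard Euclidean metric on $\mathbb{R}^m$), is an $\infty$-harmonic map if and only if it is a constant map.
   Context: A smooth map $\varphi:(M,g)\to(N,h)$ between Riemannian manifolds is called $\infty$-harmonic if $\tfrac12\,{\rm d}\varphi({\rm grad}\,|{\rm d}\varphi|^2)=0$ on $M$, where $|{\rm d}\varphi|^2={\rm Trace}_g\,\varphi^*h$ is the energy density of $\varphi$ and the gradient is taken with respect to $g$. *)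

theory Defs
  imports "HOL-Analysis.Analysis"
begin

text \<open>A map on a Euclidean space is of class \<open>C\<^sup>k\<^sup>+\<^sup>1\<close> iff it is differentiable and all its directional
  derivatives are of class \<open>C\<^sup>k\<close>.\<close>

primrec Ck_map :: "nat \<Rightarrow> ('a::euclidean_space \<Rightarrow> 'b::real_normed_vector) \<Rightarrow> bool" where
  "Ck_map 0 f \<longleftrightarrow> continuous_on UNIV f"
| "Ck_map (Suc k) f \<longleftrightarrow>
     (\<forall>x. f differentiable (at x)) \<and> (\<forall>v. Ck_map k (\<lambda>x. frechet_derivative f (at x) v))"

definition smooth_map :: "('a::euclidean_space \<Rightarrow> 'b::real_normed_vector) \<Rightarrow> bool" where
  "smooth_map f \<longleftrightarrow> (\<forall>k. Ck_map k f)"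

text \<open>A Riemannian metric on \<open>real ^ 'n\<close> is given by its Gram matrix field in the standard
  coordinates: \<open>g x $ i $ j\<close> is the metric at \<open>x\<close> applied to the \<open>i\<close>-th and \<open>j\<close>-th coordinate
  vectors, so that \<open>u \<bullet> (g x *v w)\<close> is the metric applied to tangent vectors \<open>u\<close> and \<open>w\<close>.\<close>

type_synonym 'n metric_field = "real ^ 'n \<Rightarrow> real ^ 'n ^ 'n"

definition riemannian_metric :: "'n::finite metric_field \<Rightarrow> bool" where
  "riemannian_metric g \<longleftrightarrow>
     (\<forall>i j. smooth_map (\<lambda>x. g x $ i $ j)) \<and>
     (\<forall>x. transpose (g x) = g x) \<and>
     (\<forall>x u. u \<noteq> 0 \<longrightarrow> u \<bullet> (g x *v u) > 0)"

definition pullback_metric ::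
    "(real ^ 'm \<Rightarrow> real ^ 'n) \<Rightarrow> 'n::finite metric_field \<Rightarrow> 'm::finite metric_field" where
  "pullback_metric \<phi> h x = (\<chi> i j. frechet_derivative \<phi> (at x) (axis i 1) \<bullet>
      (h (\<phi> x) *v frechet_derivative \<phi> (at x) (axis j 1)))"

text \<open>\<open>Trace\<^sub>g\<close> of a symmetric two-tensor \<open>B\<close> in coordinates is \<open>\<Sum> g\<^sup>i\<^sup>j B\<^sub>i\<^sub>j\<close>, where \<open>g\<^sup>i\<^sup>j\<close> is the inverse
  matrix of \<open>g\<close>; here \<open>B\<close> is the pullback of \<open>h\<close>.\<close>

definition energy_density ::
    "'m::finite metric_field \<Rightarrow> 'n::finite metric_field \<Rightarrow> (real ^ 'm \<Rightarrow> real ^ 'n) \<Rightarrow> real ^ 'm \<Rightarrow> real" where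
  "energy_density g h \<phi> x = trace (matrix_inv (g x) ** pullback_metric \<phi> h x)"

definition riemannian_grad ::
    "'m::finite metric_field \<Rightarrow> (real ^ 'm \<Rightarrow> real) \<Rightarrow> real ^ 'm \<Rightarrow> real ^ 'm" where
  "riemannian_grad g f x =
     matrix_inv (g x) *v (\<chi> i. frechet_derivative f (at x) (axis i 1))"

definition infinity_harmonic ::
    "'m::finite metric_field \<Rightarrow> 'n::finite metric_field \<Rightarrow> (real ^ 'm \<Rightarrow> real ^ 'n) \<Rightarrow> bool" where
  "infinity_harmonic g h \<phi> \<longleftrightarrow>
     smooth_map \<phi> \<and>
     (\<forall>x. (1 / 2) *\<^sub>R frechet_derivative \<phi> (at x) (riemannian_grad g (energy_density g h \<phi>) x) = 0)"

definition euclidean_metric_field :: "'n::finite metric_field" where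
  "euclidean_metric_field x = mat 1"

definition sol_metric :: "3 metric_field" where
  "sol_metric p = vector [vector [exp (2 * p $ 3), 0, 0],
                          vector [0, exp (- 2 * p $ 3), 0],
                          vector [0, 0, 1]]"

lemma riemannian_grad_unique:
  assumes g: "riemannian_metric g" and f: "f differentiable (at x)"
  shows "v = riemannian_grad g f x \<longleftrightarrow> (\<forall>w. v \<bullet> (g x *v w) = frechet_derivative f (at x) w)"
proof -
  let ?D = "frechet_derivative f (at x)"
  let ?d = "\<chi> i. ?D (axis i 1)"
  have sym: "transpose (g x) = g x" and pos: "\<And>u. u \<noteq> 0 \<Longrightarrow> u \<bullet> (g x *v u) > 0"
    using g by (auto simp: riemannian_metric_def)
  have "g x *v u = 0 \<Longrightarrow> u = 0" for u
    using pos[of u] by force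
  then have "invertible (g x)"
    by (simp add: invertible_left_inverse matrix_left_invertible_ker)
  then have inv: "g x ** matrix_inv (g x) = mat 1" "matrix_inv (g x) ** g x = mat 1"
    by (auto simp: invertible_def matrix_inv_def intro: someI2_ex)
  have lin: "linear ?D"
    using f by (simp add: linear_frechet_derivative)
  have d: "?D w = ?d \<bullet> w" for w
  proof -
    have "?D w = ?D (\<Sum>i\<in>UNIV. (w $ i) *s axis i 1)"
      by (simp add: basis_expansion)
    also have "\<dots> = (\<Sum>i\<in>UNIV. w $ i * ?D (axis i 1))"
      by (simp add: linear_sum[OF lin] linear_cmul[OF lin] scalar_mult_eq_scaleR)
    finally show ?thesis
      by (simp add: inner_vec_def mult.commute)
  qed
  have "v \<bullet> (g x *v w) = (g x *v v) \<bullet> w" for w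
    using dot_lmul_matrix[of v "g x" w] transpose_matrix_vector[of "g x" v] sym by simp
  then have "(\<forall>w. v \<bullet> (g x *v w) = ?D w) \<longleftrightarrow> (\<forall>w. (g x *v v) \<bullet> w = ?d \<bullet> w)"
    by (intro iff_allI) (simp only: d[symmetric])
  also have "\<dots> \<longleftrightarrow> g x *v v = ?d"
    by (rule vector_eq_rdot)
  also have "\<dots> \<longleftrightarrow> v = matrix_inv (g x) *v ?d"
  proof
    assume "g x *v v = ?d"
    then have "matrix_inv (g x) *v (g x *v v) = matrix_inv (g x) *v ?d"
      by (rule arg_cong)
    then show "v = matrix_inv (g x) *v ?d"
      by (simp add: matrix_vector_mul_assoc inv)
  next
    assume "v = matrix_inv (g x) *v ?d"
    then have "g x *v v = g x *v (matrix_inv (g x) *v ?d)"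
      by (rule arg_cong)
    then show "g x *v v = ?d"
      by (simp add: matrix_vector_mul_assoc inv)
  qed
  finally show ?thesis
    by (simp add: riemannian_grad_def)
qed

lemma smooth_map_const: "smooth_map (\<lambda>x::'a::euclidean_space. c :: 'b::real_normed_vector)"
proof -
  have "Ck_map k (\<lambda>x::'a. c)" for k and c :: 'b
    by (induction k arbitrary: c) (auto simp: frechet_derivative_const)
  then show ?thesis
    by (simp add: smooth_map_def)
qed

lemma smooth_map_exp_coord: "smooth_map (\<lambda>x::real ^ 'n::finite. exp (c * x $ i))"
proof -
  have "Ck_map k (\<lambda>x::real ^ 'n. a * exp (c * x $ i))" for k a
  proof (induction k arbitrary: a)
    case 0
    show ?case by (auto intro!: continuous_intros)
  next
    case (Suc k)
    have *: "((\<lambda>x. a * exp (c * x $ i)) has_derivative (\<lambda>v. (a * c * v $ i) * exp (c * x $ i))) (at x)"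
      for x :: "real ^ 'n"
      by (auto intro!: derivative_eq_intros)
        (rule bounded_linear_imp_has_derivative[OF bounded_linear_vec_nth])
    have "frechet_derivative (\<lambda>x. a * exp (c * x $ i)) (at x) = (\<lambda>v. (a * c * v $ i) * exp (c * x $ i))"
      for x :: "real ^ 'n"
      using frechet_derivative_at[OF *] by (rule sym)
    moreover have "(\<lambda>x. a * exp (c * x $ i)) differentiable (at x)" for x :: "real ^ 'n"
      using * unfolding differentiable_def by blast
    ultimately show ?case
      by (simp only: Ck_map.simps Suc.IH simp_thms)
  qed
  from this[of _ 1] show ?thesis
    by (simp add: smooth_map_def)
qed

lemma riemannian_metric_euclidean: "riemannian_metric euclidean_metric_field"
  by (auto simp: riemannian_metric_def euclidean_metric_field_def smooth_map_const)

lemma riemannian_metric_sol: "riemannian_metric sol_metric"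
proof -
  have "smooth_map (\<lambda>x. sol_metric x $ i $ j)" for i j
    using exhaust_3[of i] exhaust_3[of j]
      smooth_map_exp_coord[of 2 3] smooth_map_exp_coord[of "-2" 3]
    by (auto simp: sol_metric_def smooth_map_const)
  moreover have "transpose (sol_metric x) = sol_metric x" for x
    by (simp add: vec_eq_iff forall_3 transpose_def sol_metric_def)
  moreover have "u \<bullet> (sol_metric x *v u) > 0" if "u \<noteq> 0" for x u
  proof -
    have eq: "u \<bullet> (sol_metric x *v u) =
        exp (2 * x $ 3) * (u $ 1)\<^sup>2 + exp (- 2 * x $ 3) * (u $ 2)\<^sup>2 + (u $ 3)\<^sup>2"
      by (simp add: inner_vec_def matrix_vector_mult_def sum_3 sol_metric_def power2_eq_square)
    from that consider "u $ 1 \<noteq> 0" | "u $ 2 \<noteq> 0" | "u $ 3 \<noteq> 0"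
      by (auto simp: vec_eq_iff forall_3)
    then show ?thesis
      unfolding eq by cases (simp_all add: add_pos_nonneg add_nonneg_pos)
  qed
  ultimately show ?thesis
    by (simp add: riemannian_metric_def)
qed

end

theory Submission
  imports Defs "HOL-Real_Asymp.Real_Asymp"
begin

text \<open>
  Write \<open>S\<^sub>k = A\<^sub>k + A\<^sub>k\<^sup>t\<close>, so that \<open>S\<^sub>k X\<close> is the gradient of the \<open>k\<close>-th component \<open>q\<^sub>k\<close>. The energy density
  is \<open>e\<^bsup>2q\<^sub>3\<^esup> |S\<^sub>1X|\<^sup>2 + e\<^bsup>-2q\<^sub>3\<^esup> |S\<^sub>2X|\<^sup>2 + |S\<^sub>3X|\<^sup>2\<close>. Restricting the third equation to a ray on which
  \<open>q\<^sub>3\<close> does not vanish, independence of the three exponentials over the polynomials isolates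
  \<open>\<langle>S\<^sub>3X, S\<^sub>3\<^sup>2X\<rangle> = 0\<close>; if \<open>q\<^sub>3 \<noteq> 0\<close>, this extends to all \<open>X\<close> and forces \<open>S\<^sub>3 = 0\<close>. So \<open>q\<^sub>3 = 0\<close>, the target
  metric is Euclidean along the image, and with \<open>M = S\<^sub>1\<^sup>2 + S\<^sub>2\<^sup>2\<close> the other two equations say that
  \<open>S\<^sub>1\<close> and \<open>S\<^sub>2\<close> anticommute with \<open>M\<close>, whence \<open>S\<^sub>1MS\<^sub>1 + S\<^sub>2MS\<^sub>2 = -M\<^sup>2\<close>. The left-hand side is positive
  semidefinite, so \<open>M = 0\<close>.
\<close>

section \<open>Self-adjoint maps and quadratic forms\<close>

text \<open>Polarization turns the two vanishing forms into bilinear identities in \<open>x\<close>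
  and \<open>y\<close>. Taking \<open>y = A x\<close> in one and \<open>y = B x\<close> in the
  other, their sum is \<open>|M x|\<^sup>2\<close> plus two values of the nonnegative form of
  \<open>M\<close>. Hence \<open>M x = 0\<close>, and pairing with \<open>x\<close> kills
  \<open>A x\<close> and \<open>B x\<close>.\<close>

lemma selfadjoint_pair_eq_0:
  fixes A B :: "'a::real_inner \<Rightarrow> 'a"
  assumes "linear A" "linear B"
    and symA: "\<And>x y. A x \<bullet> y = x \<bullet> A y" and symB: "\<And>x y. B x \<bullet> y = x \<bullet> B y"
    and A: "\<And>x. A x \<bullet> (A (A x) + B (B x)) = 0" and B: "\<And>x. B x \<bullet> (A (A x) + B (B x)) = 0"
  shows "A x = 0 \<and> B x = 0"
proof -
  interpret A: linear A by fact
  interpret B: linear B by fact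
  define M where "M x = A (A x) + B (B x)" for x
  have M_add: "M (x + y) = M x + M y" for x y
    by (simp add: M_def A.add B.add)
  have M_nonneg: "u \<bullet> M u = A u \<bullet> A u + B u \<bullet> B u" for u
    by (simp add: M_def inner_add_right symA symB)
  have "A x \<bullet> M y + A y \<bullet> M x = 0" for x y
    using A[of "x + y", folded M_def] A[of x, folded M_def] A[of y, folded M_def]
    by (simp add: M_add A.add inner_add_left inner_add_right)
  from this[of x "A x"] have 1: "A x \<bullet> M (A x) + A (A x) \<bullet> M x = 0" .
  have "B x \<bullet> M y + B y \<bullet> M x = 0" for x y
    using B[of "x + y", folded M_def] B[of x, folded M_def] B[of y, folded M_def]
    by (simp add: M_add B.add inner_add_left inner_add_right)
  from this[of x "B x"] have 2: "B x \<bullet> M (B x) + B (B x) \<bullet> M x = 0" .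
  have "A x \<bullet> M (A x) + B x \<bullet> M (B x) + M x \<bullet> M x = 0"
    using 1 2 unfolding M_def[of x] by (simp add: inner_add_left)
  moreover have "0 \<le> A x \<bullet> M (A x)" "0 \<le> B x \<bullet> M (B x)" "0 \<le> M x \<bullet> M x"
    by (simp_all add: M_nonneg)
  ultimately have "M x \<bullet> M x = 0"
    by linarith
  then have "A x \<bullet> A x + B x \<bullet> B x = 0"
    using M_nonneg[of x] by simp
  moreover have "0 \<le> A x \<bullet> A x" "0 \<le> B x \<bullet> B x"
    by simp_all
  ultimately have "A x \<bullet> A x = 0" "B x \<bullet> B x = 0"
    by linarith+
  then show ?thesis
    by simp
qed

text \<open>On the line \<open>y + t z\<close> both forms are polynomials in \<open>t\<close> whose
  product vanishes identically. The first has leading coefficient \<open>z \<bullet> L z\<close>, so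
  the second is the zero polynomial; its constant term is the claim.\<close>

lemma quadratic_form_eq_0_of_eq_0_off_zeros:
  fixes L K :: "'a::real_inner \<Rightarrow> 'a"
  assumes "linear L" "linear K"
    and off: "\<And>x. x \<bullet> L x \<noteq> 0 \<Longrightarrow> x \<bullet> K x = 0"
    and z: "z \<bullet> L z \<noteq> 0"
  shows "y \<bullet> K y = 0"
proof -
  interpret L: linear L by fact
  interpret K: linear K by fact
  define p where "p = [:y \<bullet> L y, y \<bullet> L z + z \<bullet> L y, z \<bullet> L z:]"
  define q where "q = [:y \<bullet> K y, y \<bullet> K z + z \<bullet> K y, z \<bullet> K z:]"
  have p: "poly p t = (y + t *\<^sub>R z) \<bullet> L (y + t *\<^sub>R z)" for t
    by (simp add: p_def L.add L.scaleR inner_add_left inner_add_right algebra_simps)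
  have q: "poly q t = (y + t *\<^sub>R z) \<bullet> K (y + t *\<^sub>R z)" for t
    by (simp add: q_def K.add K.scaleR inner_add_left inner_add_right algebra_simps)
  have "poly (p * q) t = 0" for t
    using off[of "y + t *\<^sub>R z"] by (auto simp: p q)
  then have "p * q = 0"
    using poly_all_0_iff_0 by blast
  moreover have "p \<noteq> 0"
    using z by (simp add: p_def)
  ultimately have "q = 0"
    by simp
  then show ?thesis
    by (simp add: q_def)
qed

section \<open>Exponentials with affine coefficients\<close>

text \<open>Growth as \<open>s\<close> tends to infinity: multiplying by
  \<open>exp (- (k * s))\<close> forces \<open>a + b * s\<close> to tend to 0, so
  \<open>a = b = 0\<close>. What is left equates \<open>e\<close> to a decaying function.\<close>

lemma exp_poly_const_term_eq_0_pos:
  fixes a b c d e k :: real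
  assumes k: "k > 0"
    and eq: "\<And>s. s > 0 \<Longrightarrow> exp (k * s) * (a + b * s) + exp (- (k * s)) * (c + d * s) + e = 0"
  shows "e = 0"
proof -
  have "a + b * s = - (exp (- (2 * k * s)) * (c + d * s) + e * exp (- (k * s)))" if "s > 0" for s
  proof -
    have "exp (- (k * s)) * (exp (k * s) * (a + b * s) + exp (- (k * s)) * (c + d * s) + e) = 0"
      using eq[OF that] by simp
    moreover have "exp (- (k * s)) * exp (k * s) = 1"
      by (simp flip: exp_add)
    moreover have "exp (- (k * s)) * exp (- (k * s)) = exp (- (2 * k * s))"
      by (simp flip: exp_add)
    ultimately show ?thesis
      by algebra
  qed
  then have ev: "\<forall>\<^sub>F s in at_top. - (exp (- (2 * k * s)) * (c + d * s) + e * exp (- (k * s))) = a + b * s"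
    by (auto intro: eventually_mono[OF eventually_gt_at_top[of 0]])
  have "((\<lambda>s. - (exp (- (2 * k * s)) * (c + d * s) + e * exp (- (k * s)))) \<longlongrightarrow> 0) at_top"
    using k by real_asymp
  then have lim: "((\<lambda>s. a + b * s) \<longlongrightarrow> 0) at_top"
    using ev by (rule Lim_transform_eventually)
  \<comment> \<open>Division by \<open>s\<close> isolates the slope \<open>b\<close>.\<close>
  have "((\<lambda>s. (a + b * s) * inverse s) \<longlongrightarrow> 0 * 0) at_top"
    by (intro tendsto_mult lim) real_asymp
  moreover have "((\<lambda>s. (a + b * s) * inverse s) \<longlongrightarrow> b) at_top"
    by real_asymp
  ultimately have b: "b = 0"
    using tendsto_unique[OF trivial_limit_at_top_linorder] by fastforce
  with lim have a: "a = 0"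
    by (simp add: tendsto_const_iff)
  have ev': "\<forall>\<^sub>F s in at_top. - (exp (- (k * s)) * (c + d * s)) = e"
    using eventually_gt_at_top[of 0]
  proof eventually_elim
    case (elim s)
    then show ?case using eq[of s] by (simp add: a b)
  qed
  have "((\<lambda>s. - (exp (- (k * s)) * (c + d * s))) \<longlongrightarrow> 0) at_top"
    using k by real_asymp
  then have "((\<lambda>s::real. e) \<longlongrightarrow> 0) at_top"
    using ev' by (rule Lim_transform_eventually)
  then show ?thesis
    by (simp add: tendsto_const_iff)
qed

lemma exp_poly_const_term_eq_0:
  fixes a b c d e k :: real
  assumes k: "k \<noteq> 0"
    and eq: "\<And>s. s > 0 \<Longrightarrow> exp (k * s) * (a + b * s) + exp (- (k * s)) * (c + d * s) + e = 0"
  shows "e = 0"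
proof (cases "k > 0")
  case True
  then show ?thesis
    using eq by (rule exp_poly_const_term_eq_0_pos)
next
  case False
  show ?thesis
  \<comment> \<open>Passing from \<open>k\<close> to \<open>- k\<close> swaps the two exponentials
    together with their coefficients.\<close>
  proof (rule exp_poly_const_term_eq_0_pos)
    show "- k > 0" using False k by simp
    show "exp (- k * s) * (c + d * s) + exp (- (- k * s)) * (a + b * s) + e = 0" if "s > 0" for s
      using eq[OF that] by simp
  qed
qed

section \<open>Derivatives of quadratic forms and the Sol metric\<close>

lemma inner_transpose_mult:
  fixes A :: "real ^ 'n ^ 'm"
  shows "(transpose A *v x) \<bullet> y = x \<bullet> (A *v y)"
  by (simp add: transpose_matrix_vector dot_lmul_matrix)

lemma has_derivative_quadratic_form:
  fixes A :: "real ^ 'm ^ 'm"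
  shows "((\<lambda>x. x \<bullet> (A *v x)) has_derivative (\<lambda>v. ((A + transpose A) *v x) \<bullet> v)) (at x)"
proof -
  have "((\<lambda>x. x \<bullet> (A *v x)) has_derivative (\<lambda>v. x \<bullet> (A *v v) + v \<bullet> (A *v x))) (at x)"
    by (auto intro!: derivative_eq_intros bounded_linear_imp_has_derivative
        matrix_vector_mul_bounded_linear)
  moreover have "x \<bullet> (A *v v) + v \<bullet> (A *v x) = ((A + transpose A) *v x) \<bullet> v" for v
    by (simp only: matrix_vector_mult_add_rdistrib inner_add_left inner_transpose_mult
        inner_commute[of v] add.commute)
  ultimately show ?thesis
    by simp
qed

lemma inner_add_transpose:
  fixes A :: "real ^ 'm ^ 'm"
  shows "((A + transpose A) *v x) \<bullet> y = x \<bullet> ((A + transpose A) *v y)"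
  using inner_transpose_mult[of A x y] inner_transpose_mult[of A y x]
  by (simp only: matrix_vector_mult_add_rdistrib inner_add_left inner_add_right inner_commute)

lemma quadratic_form_add_transpose:
  fixes A :: "real ^ 'm ^ 'm"
  shows "x \<bullet> ((A + transpose A) *v x) = 2 * (x \<bullet> (A *v x))"
  using inner_transpose_mult[of A x x]
  by (simp only: matrix_vector_mult_add_rdistrib inner_add_right inner_commute)

lemma has_derivative_vector_3:
  fixes f g h :: "'a::real_normed_vector \<Rightarrow> real"
  assumes "(f has_derivative f') F" "(g has_derivative g') F" "(h has_derivative h') F"
  shows "((\<lambda>x. vector [f x, g x, h x] :: real ^ 3) has_derivative (\<lambda>v. vector [f' v, g' v, h' v])) F"
proof -
  have eq: "(vector [a, b, c] :: real ^ 3) = a *\<^sub>R axis 1 1 + b *\<^sub>R axis 2 1 + c *\<^sub>R axis 3 1" for a b c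
    by (simp add: vec_eq_iff forall_3 axis_def)
  show ?thesis
    unfolding eq using assms by (auto intro!: derivative_eq_intros)
qed

lemma matrix_inv_mat_1: "matrix_inv (mat 1 :: real ^ 'n ^ 'n) = mat 1"
  unfolding matrix_inv_def by (rule some_equality) auto

lemma inner_sol_metric:
  "u \<bullet> (sol_metric p *v w) =
    exp (2 * p $ 3) * (u $ 1 * w $ 1) + exp (- (2 * p $ 3)) * (u $ 2 * w $ 2) + u $ 3 * w $ 3"
  by (simp add: inner_vec_def matrix_vector_mult_def sum_3 sol_metric_def)

lemma riemannian_grad_euclidean:
  assumes "(f has_derivative (\<lambda>v. G \<bullet> v)) (at x)"
  shows "riemannian_grad euclidean_metric_field f x = G"
  using frechet_derivative_at[OF assms, symmetric]
  by (simp add: riemannian_grad_def euclidean_metric_field_def matrix_inv_mat_1 vec_eq_iff inner_axis)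

section \<open>The quadratic map and its energy gradient\<close>

context
  fixes A1 A2 A3 :: "real ^ 'm ^ 'm"
begin

definition sol_quadratic_map :: "real ^ 'm \<Rightarrow> real ^ 3" where
  "sol_quadratic_map X = vector [X \<bullet> (A1 *v X), X \<bullet> (A2 *v X), X \<bullet> (A3 *v X)]"

private abbreviation (input) "S1 \<equiv> (*v) (A1 + transpose A1)"
private abbreviation (input) "S2 \<equiv> (*v) (A2 + transpose A2)"
private abbreviation (input) "S3 \<equiv> (*v) (A3 + transpose A3)"
text \<open>This is \<open>q\<^sub>3\<close>; the Sol metric at the image of \<open>X\<close>
  depends on \<open>X\<close> only through it.\<close>

private abbreviation (input) "h X \<equiv> X \<bullet> (A3 *v X)"

lemma frechet_derivative_sol_quadratic_map:
  "frechet_derivative sol_quadratic_map (at X) = (\<lambda>v. vector [S1 X \<bullet> v, S2 X \<bullet> v, S3 X \<bullet> v])"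
  unfolding sol_quadratic_map_def[abs_def]
  by (rule frechet_derivative_at[symmetric])
    (intro has_derivative_vector_3 has_derivative_quadratic_form)

lemma energy_density_sol_quadratic_map:
  "energy_density euclidean_metric_field sol_metric sol_quadratic_map X =
    exp (2 * h X) * (S1 X \<bullet> S1 X) + exp (- (2 * h X)) * (S2 X \<bullet> S2 X) + S3 X \<bullet> S3 X"
  by (simp add: energy_density_def euclidean_metric_field_def matrix_inv_mat_1 trace_def
      pullback_metric_def frechet_derivative_sol_quadratic_map inner_sol_metric inner_axis
      sol_quadratic_map_def sum.distrib flip: sum_distrib_left)
    (simp add: inner_vec_def)

text \<open>The terms along \<open>S3 X\<close> come from differentiating the exponents, since
  \<open>S3 X\<close> is the gradient of \<open>h\<close>; their signs are those of the
  exponents.\<close>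

definition half_energy_grad :: "real ^ 'm \<Rightarrow> real ^ 'm" where
  "half_energy_grad X =
    exp (2 * h X) *\<^sub>R (S1 (S1 X) + (S1 X \<bullet> S1 X) *\<^sub>R S3 X) +
    exp (- (2 * h X)) *\<^sub>R (S2 (S2 X) - (S2 X \<bullet> S2 X) *\<^sub>R S3 X) + S3 (S3 X)"

lemma riemannian_grad_energy_density:
  "riemannian_grad euclidean_metric_field
     (energy_density euclidean_metric_field sol_metric sol_quadratic_map) X = 2 *\<^sub>R half_energy_grad X"
proof (rule riemannian_grad_euclidean)
  \<comment> \<open>Self-adjointness of \<open>S = A + transpose A\<close> makes
    \<open>2 S (S X)\<close> the gradient of \<open>|S X|\<^sup>2\<close>.\<close>
  have D: "((\<lambda>X. ((A + transpose A) *v X) \<bullet> ((A + transpose A) *v X)) has_derivative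
      (\<lambda>v. 2 * (((A + transpose A) *v ((A + transpose A) *v X)) \<bullet> v))) (at X)"
    for A :: "real ^ 'm ^ 'm"
  proof -
    let ?S = "\<lambda>v. (A + transpose A) *v v"
    have "((\<lambda>X. ?S X \<bullet> ?S X) has_derivative (\<lambda>v. ?S X \<bullet> ?S v + ?S v \<bullet> ?S X)) (at X)"
      by (intro has_derivative_inner bounded_linear_imp_has_derivative
          matrix_vector_mul_bounded_linear)
    moreover have "?S X \<bullet> ?S v + ?S v \<bullet> ?S X = 2 * (?S (?S X) \<bullet> v)" for v
      using inner_add_transpose[of A "?S X" v] inner_commute[of "?S X" "?S v"] by linarith
    ultimately show ?thesis
      by simp
  qed
  note [derivative_intros] = D has_derivative_quadratic_form
  show "(energy_density euclidean_metric_field sol_metric sol_quadratic_map has_derivative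
      (\<lambda>v. (2 *\<^sub>R half_energy_grad X) \<bullet> v)) (at X)"
    unfolding energy_density_sol_quadratic_map[abs_def] half_energy_grad_def
    by (rule derivative_eq_intros refl)+
      (simp add: inner_add_left inner_diff_left algebra_simps fun_eq_iff)
qed

lemma infinity_harmonic_sol_quadratic_mapD:
  assumes "infinity_harmonic euclidean_metric_field sol_metric sol_quadratic_map"
  shows "S1 X \<bullet> half_energy_grad X = 0" "S2 X \<bullet> half_energy_grad X = 0"
    "S3 X \<bullet> half_energy_grad X = 0"
  using assms
  by (simp_all add: infinity_harmonic_def riemannian_grad_energy_density
      frechet_derivative_sol_quadratic_map vec_eq_iff forall_3)

section \<open>Vanishing of the three components\<close>

lemma infinity_harmonic_imp_third_component_eq_0:
  assumes harm: "infinity_harmonic euclidean_metric_field sol_metric sol_quadratic_map"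
  shows "h X = 0"
proof (rule ccontr)
  assume X: "h X \<noteq> 0"
  have lin: "linear S3"
    by (rule matrix_vector_mul_linear)
  have off: "S3 Y \<bullet> S3 (S3 Y) = 0" if Y: "h Y \<noteq> 0" for Y
  proof (rule exp_poly_const_term_eq_0)
    show "2 * h Y \<noteq> 0" using Y by simp
    fix s :: real assume "s > 0"
    \<comment> \<open>Since \<open>h\<close> is homogeneous of degree 2, this parameter makes the
      exponents linear in \<open>s\<close>. The remaining factors have degree 2 or 4 in
      \<open>t\<close>, so dividing by \<open>s\<close> leaves coefficients affine in
      \<open>s\<close>.\<close>
    define t where "t = sqrt s"
    have t: "t * t = s" "t \<noteq> 0" using \<open>s > 0\<close> by (auto simp: t_def)
    have h: "2 * h (t *\<^sub>R Y) = 2 * h Y * s"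
      by (simp add: matrix_vector_mult_scaleR flip: t(1))
    have "0 = S3 (t *\<^sub>R Y) \<bullet> half_energy_grad (t *\<^sub>R Y)"
      by (rule infinity_harmonic_sol_quadratic_mapD(3)[OF harm, symmetric])
    also have "\<dots> = s * (
        exp (2 * h Y * s) * (S3 Y \<bullet> S1 (S1 Y) + (S1 Y \<bullet> S1 Y) * (S3 Y \<bullet> S3 Y) * s) +
        exp (- (2 * h Y * s)) * (S3 Y \<bullet> S2 (S2 Y) + (- (S2 Y \<bullet> S2 Y) * (S3 Y \<bullet> S3 Y)) * s) +
        S3 Y \<bullet> S3 (S3 Y))"
      unfolding half_energy_grad_def h
      by (simp only: matrix_vector_mult_scaleR inner_add_right inner_diff_right
          inner_scaleR_left inner_scaleR_right t(1)[symmetric]) algebra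
    finally show "exp (2 * h Y * s) * (S3 Y \<bullet> S1 (S1 Y) + (S1 Y \<bullet> S1 Y) * (S3 Y \<bullet> S3 Y) * s) +
        exp (- (2 * h Y * s)) * (S3 Y \<bullet> S2 (S2 Y) + (- (S2 Y \<bullet> S2 Y) * (S3 Y \<bullet> S3 Y)) * s) +
        S3 Y \<bullet> S3 (S3 Y) = 0"
      using \<open>s > 0\<close> by simp
  qed
  \<comment> \<open>The point \<open>X\<close> of the contradiction hypothesis provides the
    direction in which the form of \<open>S3\<close> is nonzero.\<close>
  have "Y \<bullet> S3 (S3 (S3 Y)) = 0" for Y
  proof (rule quadratic_form_eq_0_of_eq_0_off_zeros[where L = S3 and z = X])
    show "linear (\<lambda>x. S3 (S3 (S3 x)))"
      using linear_compose[OF linear_compose[OF lin lin] lin] by (simp add: o_def)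
    show "x \<bullet> S3 (S3 (S3 x)) = 0" if "x \<bullet> S3 x \<noteq> 0" for x
    proof -
      have "h x \<noteq> 0"
        using that quadratic_form_add_transpose[of x A3] by force
      from off[OF this] show ?thesis
        by (simp only: inner_add_transpose)
    qed
    show "X \<bullet> S3 X \<noteq> 0"
      using X quadratic_form_add_transpose[of X A3] by simp
  qed (rule lin)
  \<comment> \<open>The doubled form fits the lemma on pairs with \<open>A = B = S3\<close>.\<close>
  then have S3_cube: "S3 Y \<bullet> (S3 (S3 Y) + S3 (S3 Y)) = 0" for Y
    by (simp only: inner_add_transpose inner_add_right add_0_left)
  have "S3 X = 0 \<and> S3 X = 0"
    by (rule selfadjoint_pair_eq_0[OF lin lin inner_add_transpose inner_add_transpose S3_cube S3_cube])
  then show False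
    using X quadratic_form_add_transpose[of X A3] by simp
qed

lemma infinity_harmonic_imp_sol_quadratic_map_eq_0:
  assumes harm: "infinity_harmonic euclidean_metric_field sol_metric sol_quadratic_map"
  shows "sol_quadratic_map X = 0"
proof -
  have h: "h X = 0" for X
    by (rule infinity_harmonic_imp_third_component_eq_0[OF harm])
  \<comment> \<open>\<open>S3 X\<close> is the gradient of the identically zero function
    \<open>h\<close>.\<close>
  have "S3 X = 0" for X
    using has_derivative_unique[OF has_derivative_quadratic_form[of A3 X], of "\<lambda>v. 0"]
    by (simp add: h fun_eq_iff)
  then have G: "half_energy_grad X = S1 (S1 X) + S2 (S2 X)" for X
    by (simp only: half_energy_grad_def h) simp
  have "S1 X \<bullet> (S1 (S1 X) + S2 (S2 X)) = 0" "S2 X \<bullet> (S1 (S1 X) + S2 (S2 X)) = 0" for X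
    using infinity_harmonic_sol_quadratic_mapD(1,2)[OF harm, of X] by (simp_all only: G)
  then have "S1 X = 0 \<and> S2 X = 0"
    by (rule selfadjoint_pair_eq_0[OF matrix_vector_mul_linear matrix_vector_mul_linear
          inner_add_transpose inner_add_transpose])
  \<comment> \<open>The matrices \<open>A1\<close> and \<open>A2\<close> may keep a skew part, which
    their quadratic forms do not see.\<close>
  then have "X \<bullet> (A1 *v X) = 0" "X \<bullet> (A2 *v X) = 0"
    using quadratic_form_add_transpose[of X A1] quadratic_form_add_transpose[of X A2] by simp_all
  then show ?thesis
    by (simp add: sol_quadratic_map_def h vec_eq_iff forall_3)
qed

end

lemma infinity_harmonic_const: "infinity_harmonic g h (\<lambda>x. c)"
  by (simp add: infinity_harmonic_def smooth_map_const frechet_derivative_const)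

theorem theorem7p1:
  fixes A1 A2 A3 :: "real ^ 'm ^ 'm"
  shows "infinity_harmonic euclidean_metric_field sol_metric
           (\<lambda>X. vector [X \<bullet> (A1 *v X), X \<bullet> (A2 *v X), X \<bullet> (A3 *v X)])
     \<longleftrightarrow> (\<lambda>X. vector [X \<bullet> (A1 *v X), X \<bullet> (A2 *v X), X \<bullet> (A3 *v X)] :: real ^ 3) constant_on UNIV"
  unfolding sol_quadratic_map_def[of A1 A2 A3, symmetric]
proof
  \<comment> \<open>The constant value is 0, as a quadratic map vanishes at the origin.\<close>
  assume "infinity_harmonic euclidean_metric_field sol_metric (\<lambda>X. sol_quadratic_map A1 A2 A3 X)"
  then show "(\<lambda>X. sol_quadratic_map A1 A2 A3 X) constant_on UNIV"
    unfolding constant_on_def using infinity_harmonic_imp_sol_quadratic_map_eq_0 by blast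
next
  assume "(\<lambda>X. sol_quadratic_map A1 A2 A3 X) constant_on UNIV"
  then obtain c where "\<And>X. sol_quadratic_map A1 A2 A3 X = c"
    by (auto simp: constant_on_def)
  then show "infinity_harmonic euclidean_metric_field sol_metric (\<lambda>X. sol_quadratic_map A1 A2 A3 X)"
    by (simp add: infinity_harmonic_const)
qed

end
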